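(* Let $F=\{p_1,\dots,p_n\}$ be a finite set of (distinct) primes and let $q$ be a prime which is not in $F$. Then there exist positive integers $K_1,\dots,K_n$ and $d$ such that $$o_{(K_1+l_1,\dots,K_n+l_n)}(q)=d\,p_1^{l_1}\cdots p_n^{l_n}$$ for every $(l_1,\dots,l_n)\in\mathbb{N}^F$.
   Context: $\mathbb{N}=\{0,1,2,\dots\}$. $o_{(l_1,\dots,l_n)}(q)$ denotes the order of $(q,\dots,q)$ in $\prod_{i=1}^n\mathcal{U}(\mathbb{Z}/p_i^{l_i}\mathbb{Z})$, where $\mathcal{U}(R)$ is the group of units of a ring $R$. *)

theory Defs
  imports "HOL-Algebra.Algebra" "HOL-Computational_Algebra.Primes" "HOL-Number_Theory.Cong"
begin

text \<open>
  Tuples indexed by a set \<open>F\<close> of primes are functions on \<open>F\<close>, so \<open>l p\<close> is the exponent belonging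
  to \<open>p\<close> and \<open>\<nat>\<^sup>F\<close> is the function type \<open>nat \<Rightarrow> nat\<close> with values outside \<open>F\<close> ignored. The ring
  \<open>\<int>/m\<int>\<close> is \<^const>\<open>ZFact\<close> and the class of \<open>a\<close> in it is \<^term>\<open>ZMod m a\<close>. Unlike
  \<open>residue_ring\<close>, this is a ring also for \<open>m = 1\<close>, so a zero exponent contributes a trivial factor.
\<close>

definition units_product :: "nat set \<Rightarrow> (nat \<Rightarrow> nat) \<Rightarrow> (nat \<Rightarrow> int set) monoid" where
  "units_product F l = product_group F (\<lambda>p. units_of (ZFact (int (p ^ l p))))"

definition diagonal :: "nat set \<Rightarrow> (nat \<Rightarrow> nat) \<Rightarrow> int \<Rightarrow> nat \<Rightarrow> int set" where
  "diagonal F l q = (\<lambda>p\<in>F. ZMod (int (p ^ l p)) q)"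

text \<open>
  \<^const>\<open>group.ord\<close> is only meaningful for elements of the carrier; here that means that \<open>q\<close> is
  coprime to every \<open>p ^ l p\<close>, see \<open>diagonal_in_units_product\<close> below.
\<close>

definition ord_diagonal :: "nat set \<Rightarrow> (nat \<Rightarrow> nat) \<Rightarrow> int \<Rightarrow> nat" where
  "ord_diagonal F l q = group.ord (units_product F l) (diagonal F l q)"

lemma group_units_product: "group (units_product F l)"
proof -
  have "group (units_of (ZFact k))" for k
    using ZFact_is_cring[of k] by (simp add: cring.axioms ring.is_monoid monoid.units_group)
  then show ?thesis
    by (simp add: units_product_def)
qed

lemma ZMod_in_carrier: "ZMod m a \<in> carrier (ZFact m)"
  by (auto simp: ZMod_def ZFact_defs A_RCOSETS_def' a_r_coset_def)

lemma mult_ZFact: "ZMod m a \<otimes>\<^bsub>ZFact m\<^esub> ZMod m b = ZMod m (a * b)"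
proof -
  have "ideal (Idl\<^bsub>\<Z>\<^esub> {m}) \<Z>"
    by (simp add: int.genideal_ideal)
  then show ?thesis
    using ideal.rcoset_mult_add[of _ \<Z> a b] by (simp add: ZFact_defs ZMod_def)
qed

lemma one_ZFact: "\<one>\<^bsub>ZFact m\<^esub> = ZMod m 1"
  by (simp add: ZFact_defs ZMod_def)

lemma ZMod_in_Units:
  assumes "coprime a m"
  shows "ZMod m a \<in> Units (ZFact m)"
proof -
  obtain b where "[a * b = 1] (mod m)"
    using assms cong_solve_coprime_int by blast
  then have "ZMod m (a * b) = ZMod m 1"
    by (simp add: ZMod_eq_mod cong_def)
  then show ?thesis
    unfolding Units_def using ZMod_in_carrier
    by (auto simp: mult_ZFact one_ZFact mult.commute intro!: bexI[of _ "ZMod m b"])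
qed

lemma diagonal_in_units_product:
  assumes "\<And>p. p \<in> F \<Longrightarrow> coprime q (int (p ^ l p))"
  shows "diagonal F l q \<in> carrier (units_product F l)"
  using assms by (auto simp: units_product_def diagonal_def units_of_def intro!: ZMod_in_Units)

end

theory Submission
  imports Defs "HOL-Number_Theory.Residues"
begin

text \<open>
  An exponent \<open>n\<close> kills the diagonal element \<open>(q, \<dots>, q)\<close> iff \<open>p ^ l p\<close> divides \<open>q ^ n - 1\<close> for all
  \<open>p \<in> F\<close>, and the order is determined by the set of such \<open>n\<close> (\<open>ord_diagonal_dvd_iff\<close>).

  Let \<open>d\<close> be the order for the exponents \<open>l p = 2\<close>, and let \<open>K p \<ge> 2\<close> be the exact exponent of \<open>p\<close> in
  \<open>q ^ d - 1\<close>. If \<open>n\<close> kills the diagonal for the exponents \<open>K p + l p\<close>, then it kills it modulo the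
  squares, so \<open>n = d * n'\<close>. From there on everything happens for \<open>x = q ^ d\<close>: by lifting the exponent
  (\<open>lifting_the_exponent_dvd_iff\<close>), \<open>p ^ (K p + l p)\<close> divides \<open>x ^ n' - 1\<close> iff \<open>p ^ l p\<close> divides \<open>n'\<close>.
  As the primes are distinct, this holds for all \<open>p\<close> together iff the product of the \<open>p ^ l p\<close>
  divides \<open>n'\<close>. So the killing exponents are exactly the multiples of \<open>d\<close> times that product.

  Starting from squares rather than from the primes themselves makes the prime 2 unexceptional:
  \<open>3 - 1\<close> is divisible by 2 just once, but \<open>3 ^ 2 - 1\<close> is divisible by 8.
\<close>

lemma geometric_sum_cong:
  fixes x :: int
  assumes "[x = 1] (mod m)"
  shows "[(\<Sum>i<n. x ^ i) = int n] (mod m)"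
proof -
  have "[(\<Sum>i<n. x ^ i) = (\<Sum>i<n. 1)] (mod m)"
    using cong_pow[OF assms] by (intro cong_sum) simp
  then show ?thesis by simp
qed

text \<open>
  The cofactor of \<open>x - 1\<close> in \<open>x ^ n - 1\<close> is a geometric sum congruent to \<open>n\<close> modulo \<open>p\<close>, which decides
  whether the exponent of \<open>p\<close> grows at all; and it grows by exactly one for \<open>n = p\<close>, because that
  sum is congruent to \<open>p\<close> even modulo \<open>p ^ 2\<close>. Hence each further factor \<open>p\<close> is gained by replacing
  \<open>x\<close> by \<open>x ^ p\<close> and \<open>n\<close> by \<open>n div p\<close>.
\<close>

lemma lifting_the_exponent_dvd_iff:
  fixes p x :: int
  assumes "Factorial_Ring.prime p" "K \<ge> 2" "p ^ K dvd x - 1" "\<not> p ^ Suc K dvd x - 1"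
  shows "p ^ (K + l) dvd x ^ n - 1 \<longleftrightarrow> p ^ l dvd int n"
  using assms(2-)
proof (induction l arbitrary: K x n)
  case 0
  then show ?case
    by (simp add: power_diff_1_eq[of x n])
next
  case (Suc l)
  have p0: "p \<noteq> 0" using assms(1) by auto
  obtain u where u: "x - 1 = p ^ K * u" using Suc.prems(2) by blast
  have pu: "\<not> p dvd u"
    using Suc.prems(3) by (simp add: u p0)
  have dvd_iff: "p ^ (K + j) dvd x ^ m - 1 \<longleftrightarrow> p ^ j dvd (\<Sum>i<m. x ^ i)" for j m
  proof -
    have "p ^ (K + j) dvd x ^ m - 1 \<longleftrightarrow> p ^ j dvd u * (\<Sum>i<m. x ^ i)"
      by (simp add: power_diff_1_eq[of x m] u power_add mult.assoc p0)
    also have "\<dots> \<longleftrightarrow> p ^ j dvd (\<Sum>i<m. x ^ i)"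
      using assms(1) pu by (intro coprime_dvd_mult_right_iff) (simp add: prime_imp_coprime)
    finally show ?thesis .
  qed
  have p2: "p ^ 2 dvd x - 1"
    using Suc.prems(1,2) by (meson dvd_trans le_imp_power_dvd)
  then have "p dvd x - 1" by (rule dvd_trans[rotated]) simp
  then have sum_p: "[(\<Sum>i<m. x ^ i) = int m] (mod p)" for m
    by (intro geometric_sum_cong) (simp add: cong_iff_dvd_diff)
  have sum_p2: "[(\<Sum>i<m. x ^ i) = int m] (mod p ^ 2)" for m
    using p2 by (intro geometric_sum_cong) (simp add: cong_iff_dvd_diff)
  have p_dvd: "p dvd int n" if "p ^ (K + Suc l) dvd x ^ n - 1"
  proof -
    have "p ^ Suc l dvd (\<Sum>i<n. x ^ i)" using that dvd_iff by blast
    then have "p dvd (\<Sum>i<n. x ^ i)" by (auto intro: dvd_mult_left)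
    then show ?thesis using sum_p cong_dvd_iff by blast
  qed
  show ?case
  proof (cases "p dvd int n")
    case False
    then show ?thesis
      using p_dvd dvd_mult_left[of p "p ^ l" "int n"] by auto
  next
    case True
    have p_nat: "p = int (nat p)" using prime_gt_0_int[OF assms(1)] by simp
    obtain k where k: "n = nat p * k"
      using True p_nat by (metis dvdE int_dvd_int_iff)
    have "p ^ (Suc K) dvd x ^ nat p - 1"
      using dvd_iff[of 1 "nat p"] sum_p[of "nat p"] p_nat by (simp add: cong_dvd_iff)
    moreover have "\<not> p ^ Suc (Suc K) dvd x ^ nat p - 1"
    proof -
      have "\<not> p ^ 2 dvd p ^ 1"
        using not_prime_unit[of p] assms(1) p0 by (auto simp: power2_eq_square)
      then show ?thesis
        using dvd_iff[of 2 "nat p"] sum_p2[of "nat p"] p_nat by (simp add: cong_dvd_iff)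
    qed
    ultimately have "p ^ (Suc K + l) dvd (x ^ nat p) ^ k - 1 \<longleftrightarrow> p ^ l dvd int k"
      using Suc.prems(1) by (intro Suc.IH) auto
    moreover have "int n = p * int k" using k p_nat by simp
    ultimately show ?thesis
      using p0 prime_ge_0_int[OF assms(1)] by (simp add: k power_mult)
  qed
qed

lemma diagonal_power:
  "diagonal F l a [^]\<^bsub>units_product F l\<^esub> n = diagonal F l (a ^ n)"
proof (induction n)
  case 0
  then show ?case
    by (simp add: units_product_def diagonal_def units_of_def one_ZFact)
next
  case (Suc n)
  then show ?case
    by (auto simp: units_product_def diagonal_def units_of_def mult_ZFact mult.commute fun_eq_iff)
qed

lemma ord_diagonal_dvd_iff:
  assumes "\<And>p. p \<in> F \<Longrightarrow> coprime a (int p)"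
  shows "ord_diagonal F l a dvd n \<longleftrightarrow> (\<forall>p\<in>F. int p ^ l p dvd a ^ n - 1)"
proof -
  interpret group "units_product F l" by (rule group_units_product)
  have "diagonal F l a \<in> carrier (units_product F l)"
    using assms by (intro diagonal_in_units_product) simp
  then have "ord_diagonal F l a dvd n \<longleftrightarrow> diagonal F l (a ^ n) = \<one>\<^bsub>units_product F l\<^esub>"
    by (simp add: ord_diagonal_def flip: pow_eq_id diagonal_power)
  also have "\<one>\<^bsub>units_product F l\<^esub> = diagonal F l 1"
    using diagonal_power[of F l a 0] by simp
  also have "diagonal F l (a ^ n) = diagonal F l 1 \<longleftrightarrow>
      (\<forall>p\<in>F. ZMod (int (p ^ l p)) (a ^ n) = ZMod (int (p ^ l p)) 1)"
    unfolding diagonal_def by (metis (mono_tags, lifting) restrict_apply' restrict_ext)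
  finally show ?thesis
    by (simp add: ZMod_eq_mod mod_eq_dvd_iff)
qed

text \<open>
  Order 0 would mean that no positive exponent kills the diagonal; by Euler's theorem the product
  of the totients does.
\<close>

lemma ord_diagonal_pos:
  assumes "finite F" "\<And>p. p \<in> F \<Longrightarrow> p > 0" "\<And>p. p \<in> F \<Longrightarrow> coprime q p"
  shows "ord_diagonal F l (int q) > 0"
proof -
  define n where "n = (\<Prod>p\<in>F. totient (p ^ l p))"
  have "int p ^ l p dvd int q ^ n - 1" if p: "p \<in> F" for p
  proof -
    obtain k where k: "n = totient (p ^ l p) * k"
      using dvd_prodI[OF assms(1) p] unfolding n_def by blast
    have "[q ^ totient (p ^ l p) = 1] (mod p ^ l p)"
      using assms(3)[OF p] by (intro euler_theorem) simp
    then have "[q ^ n = 1] (mod p ^ l p)"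
      using cong_pow[of _ 1 _ k] by (metis k power_mult power_one)
    then have "[int (q ^ n) = int 1] (mod int (p ^ l p))"
      by (simp only: cong_int_iff)
    then show ?thesis
      by (simp add: cong_iff_dvd_diff)
  qed
  then have "ord_diagonal F l (int q) dvd n"
    using assms(3) by (simp add: ord_diagonal_dvd_iff)
  moreover have "n > 0"
    using assms by (simp add: n_def prod_pos)
  ultimately show ?thesis by (meson dvd_pos_nat)
qed

lemma prod_prime_powers_dvd_iff:
  fixes n :: nat
  assumes "finite F" "\<And>p. p \<in> F \<Longrightarrow> Factorial_Ring.prime p"
  shows "(\<Prod>p\<in>F. p ^ l p) dvd n \<longleftrightarrow> (\<forall>p\<in>F. p ^ l p dvd n)"
  using assms
proof (induction F rule: finite_induct)
  case (insert p F)
  have "coprime (p ^ l p) (\<Prod>p\<in>F. p ^ l p)"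
    using insert.hyps insert.prems by (intro prod_coprime_right) (auto intro!: primes_coprime)
  then have "p ^ l p * (\<Prod>p\<in>F. p ^ l p) dvd n \<longleftrightarrow> p ^ l p dvd n \<and> (\<Prod>p\<in>F. p ^ l p) dvd n"
    by (meson divides_mult dvd_mult_left dvd_mult_right)
  then show ?case
    using insert by simp
qed simp

theorem propositionA5:
  fixes F :: "nat set" and q :: nat
  assumes "finite F"
    and "\<And>p. p \<in> F \<Longrightarrow> Factorial_Ring.prime p"
    and "Factorial_Ring.prime q"
    and "q \<notin> F"
  shows "\<exists>(K :: nat \<Rightarrow> nat) (d :: nat). (\<forall>p\<in>F. K p > 0) \<and> d > 0 \<and>
    (\<forall>l :: nat \<Rightarrow> nat. ord_diagonal F (\<lambda>p. K p + l p) (int q) = d * (\<Prod>p\<in>F. p ^ l p))"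
proof -
  have coprime: "coprime q p" if "p \<in> F" for p
    using assms that by (metis primes_coprime)
  then have dvd_iff: "ord_diagonal F l (int q) dvd n \<longleftrightarrow>
      (\<forall>p\<in>F. int p ^ l p dvd int q ^ n - 1)" for l n
    by (intro ord_diagonal_dvd_iff) simp
  define d where "d = ord_diagonal F (\<lambda>_. 2) (int q)"
  define x where "x = int q ^ d"
  define K where "K p = multiplicity (int p) (x - 1)" for p :: nat
  have d_pos: "d > 0"
    unfolding d_def using assms(1,2) coprime by (intro ord_diagonal_pos) (auto simp: prime_gt_0_nat)
  have "x > 1"
    unfolding x_def using d_pos prime_gt_1_nat[OF assms(3)] by (intro one_less_power) auto
  then have x: "x - 1 \<noteq> 0" by simp
  have not_unit: "\<not> is_unit (int p)" if "p \<in> F" for p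
    using prime_gt_1_nat[OF assms(2)[OF that]] by simp
  have K: "K p \<ge> 2" if "p \<in> F" for p
  proof -
    have "int p ^ 2 dvd x - 1"
      using dvd_iff[of "\<lambda>_. 2" d] that by (simp add: d_def x_def)
    then show ?thesis
      using x not_unit[OF that] by (simp add: K_def power_dvd_iff_le_multiplicity)
  qed
  have lift: "int p ^ (K p + l p) dvd x ^ n - 1 \<longleftrightarrow> p ^ l p dvd n" if "p \<in> F" for p l n
  proof -
    have "\<not> int p ^ Suc (K p) dvd x - 1"
      using power_dvd_iff_le_multiplicity[OF x not_unit[OF that], of "Suc (K p)"]
      by (simp add: K_def)
    then have "int p ^ (K p + l p) dvd x ^ n - 1 \<longleftrightarrow> int p ^ l p dvd int n"
      using K[OF that] assms(2)[OF that]
      by (intro lifting_the_exponent_dvd_iff) (auto simp: K_def multiplicity_dvd)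
    then show ?thesis
      by (simp flip: of_nat_power)
  qed
  have "ord_diagonal F (\<lambda>p. K p + l p) (int q) = d * (\<Prod>p\<in>F. p ^ l p)" for l
  proof -
    have iff: "ord_diagonal F (\<lambda>p. K p + l p) (int q) dvd n \<longleftrightarrow> d * (\<Prod>p\<in>F. p ^ l p) dvd n" for n
    proof (cases "d dvd n")
      case True
      then obtain k where k: "n = d * k" by blast
      have "ord_diagonal F (\<lambda>p. K p + l p) (int q) dvd n \<longleftrightarrow> (\<forall>p\<in>F. p ^ l p dvd k)"
        using lift by (simp add: dvd_iff k power_mult flip: x_def)
      then show ?thesis
        using d_pos assms(1,2) by (simp add: k prod_prime_powers_dvd_iff)
    next
      case False
      have "d dvd n" if kills: "ord_diagonal F (\<lambda>p. K p + l p) (int q) dvd n"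
      proof -
        have "int p ^ 2 dvd int q ^ n - 1" if "p \<in> F" for p
        proof -
          have "int p ^ 2 dvd int p ^ (K p + l p)"
            using K[OF that] by (intro le_imp_power_dvd) simp
          moreover have "int p ^ (K p + l p) dvd int q ^ n - 1"
            using kills that by (simp add: dvd_iff)
          ultimately show ?thesis by (rule dvd_trans)
        qed
        then show ?thesis by (simp add: d_def dvd_iff)
      qed
      with False show ?thesis by (auto dest: dvd_mult_left)
    qed
    show ?thesis
      using iff[of "ord_diagonal F (\<lambda>p. K p + l p) (int q)"] iff[of "d * (\<Prod>p\<in>F. p ^ l p)"]
      by (intro dvd_antisym) simp_all
  qed
  moreover have "\<forall>p\<in>F. K p > 0" using K by fastforce
  ultimately show ?thesis using d_pos by blast
qed

end
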